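(* Let $\psi:R\to R^*$ be a $G_0$-equivariant isomorphism; it is either symmetric ($\psi(r)(t)=\psi(t)(r)$) or alternating ($\psi(r)(t)=-\psi(t)(r)$). For \[M=\begin{pmatrix}\mathsf A&\mathsf B\\ \mathsf K&\mathsf D\end{pmatrix}\in\mathrm{End}(H\oplus H^* )\] (with $\mathsf A:H\to H$, $\mathsf B:H^*\to H$, $\mathsf K:H\to H^*$, $\mathsf D:H^*\to H^*$), let $\Phi(M)$ be the $G_0$-equivariant operator on $(H\otimes R)\oplus(H^*\otimes R^* )$ given by \[\begin{pmatrix}\mathsf A\otimes\mathrm{Id}_R&\mathsf B\otimes\psi^{-1}\\ \mathsf K\otimes\psi&\mathsf D\otimes\mathrm{Id}_{R^*}\end{pmatrix}.\] Then $\Phi(M)$ respects $b$ if and only if $M$ respects - the symmetric form $s(h_1+f_1,h_2+f_2)=f_1(h_2)+f_2(h_1)$ when $\psi$ is symmetric, resp. - the alternating form $a(h_1+f_1,h_2+f_2)=f_1(h_2)-f_2(h_1)$ when $\psi$ is alternating.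
   Context: Setting: - $G_0$ is a compact group, and $R$ is a finite-dimensional irreducible unitary $G_0$-representation isomorphic to its dual $R^*$. - $V$ is a finite-dimensional unitary $G_0$-representation all of whose irreducible subrepresentations are isomorphic to $R$. Duals carry the action $g(f)=f\circ g^{-1}$. - $H=\mathrm{Hom}_{G_0}(R,V)$, $H^*=\mathrm{Hom}_{G_0}(R^*,V^* )$, paired by $f(h)=\sum_i f(\vartheta_i)(h(e_i))$, where $(e_i)$ is a basis of $R$ and $(\vartheta_i)$ is the dual basis. - $\varepsilon:(H\otimes R)\oplus(H^*\otimes R^* )\to V\oplus V^*$, $h\otimes r+f\otimes t\mapsto h(r)+f(t)$, is a $G_0$-equivariant isomorphism. - $b$ denotes the pullback via $\varepsilon$ of the symmetric form $b_0(v_1+f_1,v_2+f_2)=f_1(v_2)+f_2(v_1)$ on $V\oplus V^*$. A linear map $M$ respects a bilinear form $F$ either as an isometry, $F(Mw_1,Mw_2)=F(w_1,w_2)$ (for invertible $M$), or infinitesimally, $F(Mw_1,w_2)+F(w_1,Mw_2)=0$. The equivalence holds in each sense. *)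

theory Defs
  imports "HOL-Analysis.Analysis" "HOL-Algebra.Group"
begin

text \<open>Conventions. All spaces are finite-dimensional complex coordinate spaces
 \<open>complex^'n\<close>; linear maps are matrices acting by \<open>*v\<close>. The dual of \<open>complex^'n\<close>
 is again \<open>complex^'n\<close> (coordinates w.r.t. the dual basis), the evaluation
 pairing being \<open>cdot\<close>.\<close>

definition cdot :: "complex^'n \<Rightarrow> complex^'n \<Rightarrow> complex" where
  "cdot f v = (\<Sum>i\<in>UNIV. f$i * v$i)"

definition cadjoint :: "complex^'n^'m \<Rightarrow> complex^'m^'n" where
  "cadjoint A = (\<chi> i j. cnj (A$j$i))"

text \<open>Compact (Hausdorff) topological group, modelled as an HOL-Algebra group
 whose carrier lives in a topological space.\<close>
definition compact_group :: "('g::t2_space, 'b) monoid_scheme \<Rightarrow> bool" where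
  "compact_group G \<longleftrightarrow> group G \<and> compact (carrier G) \<and>
     continuous_on (carrier G \<times> carrier G) (\<lambda>(x,y). x \<otimes>\<^bsub>G\<^esub> y) \<and>
     continuous_on (carrier G) (\<lambda>x. inv\<^bsub>G\<^esub> x)"

text \<open>Finite-dimensional continuous unitary representation on \<open>complex^'n\<close>.\<close>
definition unitary_rep :: "('g::t2_space, 'b) monoid_scheme \<Rightarrow> ('g \<Rightarrow> complex^'n^'n) \<Rightarrow> bool" where
  "unitary_rep G \<rho> \<longleftrightarrow> continuous_on (carrier G) \<rho> \<and> \<rho> \<one>\<^bsub>G\<^esub> = mat 1 \<and>
     (\<forall>x\<in>carrier G. \<forall>y\<in>carrier G. \<rho> (x \<otimes>\<^bsub>G\<^esub> y) = \<rho> x ** \<rho> y) \<and>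
     (\<forall>x\<in>carrier G. \<rho> x ** cadjoint (\<rho> x) = mat 1)"

text \<open>Dual representation \<open>g(f) = f \<circ> g\<^sup>-\<^sup>1\<close> in dual-basis coordinates.\<close>
definition dual_rep :: "('g \<Rightarrow> complex^'n^'n) \<Rightarrow> 'g \<Rightarrow> complex^'n^'n" where
  "dual_rep \<rho> g = transpose (matrix_inv (\<rho> g))"

definition invariant_subspace :: "('g, 'b) monoid_scheme \<Rightarrow> ('g \<Rightarrow> complex^'n^'n) \<Rightarrow> (complex^'n) set \<Rightarrow> bool" where
  "invariant_subspace G \<rho> W \<longleftrightarrow> vec.subspace W \<and> (\<forall>g\<in>carrier G. \<forall>w\<in>W. \<rho> g *v w \<in> W)"

definition irreducible_rep :: "('g, 'b) monoid_scheme \<Rightarrow> ('g \<Rightarrow> complex^'n^'n) \<Rightarrow> bool" where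
  "irreducible_rep G \<rho> \<longleftrightarrow> (\<forall>W. invariant_subspace G \<rho> W \<longrightarrow> W = {0} \<or> W = UNIV)"

text \<open>An irreducible subrepresentation \<open>W\<close> of \<open>\<rho>\<close>.\<close>
definition irreducible_subrep :: "('g, 'b) monoid_scheme \<Rightarrow> ('g \<Rightarrow> complex^'n^'n) \<Rightarrow> (complex^'n) set \<Rightarrow> bool" where
  "irreducible_subrep G \<rho> W \<longleftrightarrow> invariant_subspace G \<rho> W \<and> W \<noteq> {0} \<and>
     (\<forall>W'. W' \<subseteq> W \<longrightarrow> invariant_subspace G \<rho> W' \<longrightarrow> W' = {0} \<or> W' = W)"

text \<open>\<open>W\<close> (a subrepresentation of \<open>\<rho>V\<close>) is isomorphic to the representation \<open>\<rho>R\<close>.\<close>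
definition subrep_iso :: "('g, 'b) monoid_scheme \<Rightarrow> ('g \<Rightarrow> complex^'r^'r) \<Rightarrow> ('g \<Rightarrow> complex^'v^'v) \<Rightarrow> (complex^'v) set \<Rightarrow> bool" where
  "subrep_iso G \<rho>R \<rho>V W \<longleftrightarrow> (\<exists>T::complex^'r^'v. inj ((*v) T) \<and> range ((*v) T) = W \<and>
     (\<forall>g\<in>carrier G. T ** \<rho>R g = \<rho>V g ** T))"

text \<open>Equivariant linear maps (intertwiners) \<open>Hom_G(\<rho>1,\<rho>2)\<close>, as matrices.\<close>
definition equiv_maps :: "('g, 'b) monoid_scheme \<Rightarrow> ('g \<Rightarrow> complex^'r^'r) \<Rightarrow> ('g \<Rightarrow> complex^'v^'v) \<Rightarrow> (complex^'r^'v) set" where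
  "equiv_maps G \<rho>1 \<rho>2 = {T. \<forall>g\<in>carrier G. T ** \<rho>1 g = \<rho>2 g ** T}"

text \<open>Linear combination of a family of matrices.\<close>
definition mat_comb :: "complex^'k \<Rightarrow> ('k \<Rightarrow> complex^'r^'v) \<Rightarrow> complex^'r^'v" where
  "mat_comb x b = (\<chi> p q. \<Sum>i\<in>UNIV. x$i * b i $ p $ q)"

text \<open>\<open>b\<close> is a basis of the (complex) space of matrices \<open>S\<close>.\<close>
definition is_mat_basis :: "('k::finite \<Rightarrow> complex^'r^'v) \<Rightarrow> (complex^'r^'v) set \<Rightarrow> bool" where
  "is_mat_basis b S \<longleftrightarrow> (\<forall>x. mat_comb x b \<in> S) \<and> (\<forall>x. mat_comb x b = 0 \<longrightarrow> x = 0) \<and>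
     (\<forall>T\<in>S. \<exists>x. T = mat_comb x b)"

text \<open>Pairing \<open>H\<^sup>* \<times> H \<rightarrow> \<complex>\<close>: \<open>f(h) = \<Sum>\<^sub>i f(\<vartheta>\<^sub>i)(h(e\<^sub>i))\<close>, for matrices \<open>f : R\<^sup>* \<rightarrow> V\<^sup>*\<close>, \<open>h : R \<rightarrow> V\<close>.\<close>
definition hom_pair :: "complex^'r^'v \<Rightarrow> complex^'r^'v \<Rightarrow> complex" where
  "hom_pair f h = (\<Sum>i\<in>UNIV. cdot (f *v axis i 1) (h *v axis i 1))"

text \<open>The forms \<open>s\<close> and \<open>a\<close> on \<open>H \<oplus> H\<^sup>*\<close>, where \<open>H \<cong> complex^'k\<close> via basis \<open>hb\<close>
 and \<open>H\<^sup>* \<cong> complex^'l\<close> via basis \<open>fb\<close>.\<close>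
definition form_s :: "('k::finite \<Rightarrow> complex^'r^'v) \<Rightarrow> ('l::finite \<Rightarrow> complex^'r^'v) \<Rightarrow>
    ((complex^'k) \<times> (complex^'l)) \<Rightarrow> ((complex^'k) \<times> (complex^'l)) \<Rightarrow> complex" where
  "form_s hb fb w1 w2 = (case w1 of (h1, f1) \<Rightarrow> case w2 of (h2, f2) \<Rightarrow>
     hom_pair (mat_comb f1 fb) (mat_comb h2 hb) + hom_pair (mat_comb f2 fb) (mat_comb h1 hb))"

definition form_a :: "('k::finite \<Rightarrow> complex^'r^'v) \<Rightarrow> ('l::finite \<Rightarrow> complex^'r^'v) \<Rightarrow>
    ((complex^'k) \<times> (complex^'l)) \<Rightarrow> ((complex^'k) \<times> (complex^'l)) \<Rightarrow> complex" where
  "form_a hb fb w1 w2 = (case w1 of (h1, f1) \<Rightarrow> case w2 of (h2, f2) \<Rightarrow>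
     hom_pair (mat_comb f1 fb) (mat_comb h2 hb) - hom_pair (mat_comb f2 fb) (mat_comb h1 hb))"

text \<open>Tensor products: \<open>H \<otimes> R \<cong> complex^'k \<otimes> complex^'r\<close> is modelled as \<open>'k \<times> 'r\<close>
 coefficient matrices \<open>complex^'r^'k\<close> (pure tensor \<open>h \<otimes> r\<close> = outer product), and
 similarly \<open>H\<^sup>* \<otimes> R\<^sup>* \<cong> complex^'r^'l\<close>. The map \<open>\<epsilon>\<close>: \<open>h \<otimes> r + f \<otimes> t \<mapsto> h(r) + f(t)\<close>.\<close>
definition eps :: "('k::finite \<Rightarrow> complex^'r^'v) \<Rightarrow> ('l::finite \<Rightarrow> complex^'r^'v) \<Rightarrow>
    ((complex^'r^'k) \<times> (complex^'r^'l)) \<Rightarrow> ((complex^'v) \<times> (complex^'v))" where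
  "eps hb fb X = (case X of (X1, X2) \<Rightarrow>
     ((\<chi> p. \<Sum>i\<in>UNIV. \<Sum>j\<in>UNIV. X1$i$j * (hb i *v axis j 1)$p),
      (\<chi> p. \<Sum>i\<in>UNIV. \<Sum>j\<in>UNIV. X2$i$j * (fb i *v axis j 1)$p)))"

text \<open>The symmetric form \<open>b\<^sub>0\<close> on \<open>V \<oplus> V\<^sup>*\<close> and its pullback \<open>b\<close>.\<close>
definition form_b0 :: "((complex^'v) \<times> (complex^'v)) \<Rightarrow> ((complex^'v) \<times> (complex^'v)) \<Rightarrow> complex" where
  "form_b0 w1 w2 = (case w1 of (v1, f1) \<Rightarrow> case w2 of (v2, f2) \<Rightarrow> cdot f1 v2 + cdot f2 v1)"

definition form_b :: "('k::finite \<Rightarrow> complex^'r^'v) \<Rightarrow> ('l::finite \<Rightarrow> complex^'r^'v) \<Rightarrow>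
    ((complex^'r^'k) \<times> (complex^'r^'l)) \<Rightarrow> ((complex^'r^'k) \<times> (complex^'r^'l)) \<Rightarrow> complex" where
  "form_b hb fb X Y = form_b0 (eps hb fb X) (eps hb fb Y)"

text \<open>The block operator \<open>M = [A B; K D]\<close> on \<open>H \<oplus> H\<^sup>*\<close>.\<close>
definition block_op :: "complex^'k^'k \<Rightarrow> complex^'l^'k \<Rightarrow> complex^'k^'l \<Rightarrow> complex^'l^'l \<Rightarrow>
    ((complex^'k) \<times> (complex^'l)) \<Rightarrow> ((complex^'k) \<times> (complex^'l))" where
  "block_op A B K D w = (case w of (h, f) \<Rightarrow> (A *v h + B *v f, K *v h + D *v f))"

text \<open>\<open>\<Phi>(M) = [A\<otimes>Id, B\<otimes>\<psi>\<^sup>-\<^sup>1; K\<otimes>\<psi>, D\<otimes>Id]\<close>; \<open>(S \<otimes> C) X = S ** X ** transpose C\<close>.\<close>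
definition Phi_op :: "complex^'r^'r \<Rightarrow> complex^'k^'k \<Rightarrow> complex^'l^'k \<Rightarrow> complex^'k^'l \<Rightarrow> complex^'l^'l \<Rightarrow>
    ((complex^'r^'k) \<times> (complex^'r^'l)) \<Rightarrow> ((complex^'r^'k) \<times> (complex^'r^'l))" where
  "Phi_op \<psi> A B K D X = (case X of (X1, X2) \<Rightarrow>
     (A ** X1 + B ** X2 ** transpose (matrix_inv \<psi>), K ** X1 ** transpose \<psi> + D ** X2))"

definition respects_isometry :: "('w \<Rightarrow> 'w \<Rightarrow> complex) \<Rightarrow> ('w \<Rightarrow> 'w) \<Rightarrow> bool" where
  "respects_isometry F T \<longleftrightarrow> (\<forall>w1 w2. F (T w1) (T w2) = F w1 w2)"

definition respects_infinitesimal :: "('w \<Rightarrow> 'w \<Rightarrow> complex) \<Rightarrow> ('w \<Rightarrow> 'w) \<Rightarrow> bool" where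
  "respects_infinitesimal F T \<longleftrightarrow> (\<forall>w1 w2. F (T w1) w2 + F w1 (T w2) = 0)"

end

theory Submission
  imports Defs "Jordan_Normal_Form.Spectral_Radius"
begin

text \<open>For \<open>f \<in> H\<^sup>*\<close> and \<open>h \<in> H\<close> the matrix \<open>f\<^sup>T h\<close> commutes with \<open>R\<close>, so by Schur's lemma it is
  the scalar \<open>f(h) / dim R\<close>. Hence, once \<open>H\<^sup>* \<otimes> R\<^sup>*\<close> is identified with \<open>H\<^sup>* \<otimes> R\<close> through \<open>\<psi>\<close>, the
  form \<open>b\<close> is \<open>1 / dim R\<close> times the tensor product of a form on \<open>H \<oplus> H\<^sup>*\<close> with the bilinear
  form of \<open>\<psi>\<close> on \<open>R\<close>. The two halves of \<open>b\<close> are related by transposing \<open>\<psi>\<close>, so that form on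
  \<open>H \<oplus> H\<^sup>*\<close> is \<open>s\<close> when \<open>\<psi>\<close> is symmetric and \<open>a\<close> when it is alternating. In the same
  coordinates \<open>\<Phi>(M)\<close> becomes \<open>M \<otimes> Id\<^sub>R\<close>, and a form \<open>F \<otimes> \<beta>\<close> with \<open>\<beta> \<noteq> 0\<close> is respected by
  \<open>M \<otimes> Id\<close> exactly when \<open>F\<close> is respected by \<open>M\<close>.\<close>

text \<open>Jordan_Normal_Form is used only for the existence of an eigenvalue; \<open>mat\<close> and \<open>$\<close>
  keep their meaning for Cartesian-product matrices.\<close>
hide_const (open) Matrix.mat
no_notation Matrix.vec_index (infixl \<open>$\<close> 100)

lemma eigenvector_reindex:
  fixes N :: "'a::comm_ring_1^'n^'n"
  assumes e: "bij_betw e {0..<n} (UNIV :: 'n set)"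
    and v: "eigenvector (Matrix.mat n n (\<lambda>(i, j). N $ e i $ e j)) v k"
  defines "w \<equiv> \<chi> a. vec_index v (inv_into {0..<n} e a)"
  shows "w \<noteq> 0" and "N *v w = k *s w"
proof -
  define e' where "e' = inv_into {0..<n} e"
  have e'_e: "e' (e j) = j" if "j < n" for j
    using bij_betw_inv_into_left[OF e] that by (simp add: e'_def)
  have e_e': "e (e' a) = a" and e'_less: "e' a < n" for a
    using bij_betw_inv_into_right[OF e] bij_betw_apply[OF bij_betw_inv_into[OF e]]
    by (auto simp: e'_def)
  define NJ where "NJ = Matrix.mat n n (\<lambda>(i, j). N $ e i $ e j)"
  from v have v: "v \<in> carrier_vec n" "v \<noteq> 0\<^sub>v n" "NJ *\<^sub>v v = k \<cdot>\<^sub>v v"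
    by (auto simp: eigenvector_def NJ_def)
  show "w \<noteq> 0"
  proof
    assume "w = 0"
    have "v = 0\<^sub>v n"
    proof (rule eq_vecI)
      fix j assume j: "j < dim_vec (0\<^sub>v n :: 'a vec)"
      then have "vec_index v j = w $ e j"
        by (simp add: w_def e'_def[symmetric] e'_e)
      then show "vec_index v j = vec_index (0\<^sub>v n) j"
        using \<open>w = 0\<close> j by simp
    qed (use v(1) in simp)
    with v(2) show False ..
  qed
  show "N *v w = k *s w"
  proof (rule Finite_Cartesian_Product.vec_eq_iff[THEN iffD2], rule allI)
    fix a
    have "(N *v w) $ a = (\<Sum>b\<in>UNIV. N $ a $ b * vec_index v (e' b))"
      by (simp add: matrix_vector_mult_def w_def e'_def)
    also have "\<dots> = (\<Sum>j\<in>{0..<n}. N $ a $ e j * vec_index v (e' (e j)))"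
      using sum.reindex_bij_betw[OF e, of "\<lambda>b. N $ a $ b * vec_index v (e' b)"] by simp
    also have "\<dots> = (\<Sum>j\<in>{0..<n}. N $ e (e' a) $ e j * vec_index v j)"
      by (intro sum.cong) (auto simp: e'_e e_e')
    also have "\<dots> = vec_index (NJ *\<^sub>v v) (e' a)"
      using e'_less v(1) by (simp add: NJ_def scalar_prod_def row_def)
    also have "\<dots> = k * vec_index v (e' a)"
      using v(1,3) e'_less by simp
    finally show "(N *v w) $ a = (k *s w) $ a"
      by (simp add: w_def e'_def)
  qed
qed

lemma complex_matrix_has_eigenvector:
  fixes N :: "complex^'n^'n"
  obtains c v where "v \<noteq> 0" and "N *v v = c *s v"
proof -
  obtain e :: "nat \<Rightarrow> 'n" where e: "bij_betw e {0..<CARD('n)} UNIV"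
    using ex_bij_betw_nat_finite[of "UNIV :: 'n set"] by auto
  define NJ where "NJ = Matrix.mat CARD('n) CARD('n) (\<lambda>(i, j). N $ e i $ e j)"
  have "NJ \<in> carrier_mat CARD('n) CARD('n)"
    by (simp add: NJ_def)
  then obtain k where "eigenvalue NJ k"
    using spectrum_non_empty[of NJ "CARD('n)"] by (auto simp: spectrum_def)
  then obtain v where "eigenvector NJ v k"
    by (auto simp: eigenvalue_def)
  then show thesis
    using that eigenvector_reindex[OF e] unfolding NJ_def by blast
qed

lemma irreducible_rep_commutant_scalar:
  fixes N :: "complex^'n^'n" and \<rho> :: "'g \<Rightarrow> complex^'n^'n"
  assumes irr: "irreducible_rep G \<rho>" and comm: "\<forall>g\<in>carrier G. N ** \<rho> g = \<rho> g ** N"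
  obtains c where "\<And>v. N *v v = c *s v"
proof -
  obtain c v where v: "v \<noteq> 0" "N *v v = c *s v"
    by (rule complex_matrix_has_eigenvector)
  define E where "E = {w. N *v w = c *s w}"
  have "vec.subspace E"
    unfolding vec.subspace_def E_def
    by (auto simp: matrix_vector_right_distrib vector_ssub_ldistrib vector_scalar_commute)
  moreover have "\<rho> g *v w \<in> E" if g: "g \<in> carrier G" and w: "w \<in> E" for g w
  proof -
    have "N *v (\<rho> g *v w) = (\<rho> g ** N) *v w"
      using comm g by (simp add: matrix_vector_mul_assoc)
    also have "\<dots> = c *s (\<rho> g *v w)"
      using w by (simp add: E_def flip: matrix_vector_mul_assoc add: vector_scalar_commute)
    finally show ?thesis by (simp add: E_def)
  qed
  ultimately have "invariant_subspace G \<rho> E"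
    unfolding invariant_subspace_def by blast
  with irr v have "E = UNIV"
    unfolding irreducible_rep_def E_def by blast
  then show thesis
    using that unfolding E_def by blast
qed

lemma invertible_matrix_inv:
  fixes A :: "'a::field^'n^'n"
  assumes "invertible A"
  shows "A ** matrix_inv A = mat 1" and "matrix_inv A ** A = mat 1"
  using someI_ex[of "\<lambda>A'. A ** A' = mat 1 \<and> A' ** A = mat 1"] assms
  by (auto simp: invertible_def matrix_inv_def)

lemma invertible_nonzero_entry:
  fixes A :: "'a::field^'n^'n"
  assumes "invertible A"
  obtains i j where "A $ i $ j \<noteq> 0"
proof (rule ccontr)
  assume "\<not> thesis"
  with that have "A = 0"
    by (auto simp: Finite_Cartesian_Product.vec_eq_iff)
  then have "(mat 1 :: 'a^'n^'n) = 0"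
    using invertible_matrix_inv(1)[OF assms] by simp
  then have "(mat 1 :: 'a^'n^'n) $ undefined $ undefined = 0"
    by simp
  then show False
    by (simp add: Finite_Cartesian_Product.mat_def)
qed

lemma unitary_rep_invertible:
  assumes "unitary_rep G \<rho>" and "g \<in> carrier G"
  shows "invertible (\<rho> g)"
  using assms unfolding unitary_rep_def invertible_right_inverse by blast

lemma transpose_mult_intertwines:
  fixes f h :: "complex^'r^'v"
  assumes R_inv: "\<And>g. g \<in> carrier G \<Longrightarrow> invertible (\<rho>R g)"
    and V_inv: "\<And>g. g \<in> carrier G \<Longrightarrow> invertible (\<rho>V g)"
    and f: "f \<in> equiv_maps G (dual_rep \<rho>R) (dual_rep \<rho>V)"
    and h: "h \<in> equiv_maps G \<rho>R \<rho>V"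
  shows "\<forall>g\<in>carrier G. (transpose f ** h) ** \<rho>R g = \<rho>R g ** (transpose f ** h)"
proof
  fix g assume g: "g \<in> carrier G"
  define Rg Vg where "Rg = \<rho>R g" and "Vg = \<rho>V g"
  note R = invertible_matrix_inv[OF R_inv[OF g, folded Rg_def]]
    and V = invertible_matrix_inv[OF V_inv[OF g, folded Vg_def]]
  have "f ** transpose (matrix_inv Rg) = transpose (matrix_inv Vg) ** f"
    using f g unfolding equiv_maps_def dual_rep_def Rg_def Vg_def by auto
  then have "transpose (f ** transpose (matrix_inv Rg)) = transpose (transpose (matrix_inv Vg) ** f)"
    by simp
  then have f_inv: "matrix_inv Rg ** transpose f = transpose f ** matrix_inv Vg"
    by (simp add: matrix_transpose_mul)
  have "transpose f ** Vg = (Rg ** matrix_inv Rg) ** transpose f ** Vg"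
    using R by simp
  also have "\<dots> = Rg ** (matrix_inv Rg ** transpose f) ** Vg"
    by (simp add: matrix_mul_assoc)
  also have "\<dots> = Rg ** transpose f ** (matrix_inv Vg ** Vg)"
    by (simp add: f_inv matrix_mul_assoc)
  finally have f_eq: "transpose f ** Vg = Rg ** transpose f"
    using V by simp
  have h_eq: "h ** Rg = Vg ** h"
    using h g unfolding equiv_maps_def Rg_def Vg_def by auto
  have "(transpose f ** h) ** Rg = transpose f ** Vg ** h"
    by (simp add: h_eq flip: matrix_mul_assoc)
  also have "\<dots> = Rg ** (transpose f ** h)"
    by (simp add: f_eq matrix_mul_assoc)
  finally show "(transpose f ** h) ** \<rho>R g = \<rho>R g ** (transpose f ** h)"
    by (simp add: Rg_def)
qed

lemma cdot_transpose: "cdot (B *v a) b = cdot a (transpose B *v b)"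
  unfolding cdot_def matrix_vector_mult_def transpose_def
  by (simp add: sum_distrib_left sum_distrib_right mult_ac) (rule sum.swap)

lemma cdot_scale_left: "cdot (c *s a) b = c * cdot a b"
  unfolding cdot_def by (simp add: sum_distrib_left mult_ac)

lemma cdot_scale_right: "cdot a (c *s b) = c * cdot a b"
  unfolding cdot_def by (simp add: sum_distrib_left mult_ac)

lemma cdot_sum_left: "cdot (sum u A) v = (\<Sum>a\<in>A. cdot (u a) v)"
  unfolding cdot_def by (simp add: sum_component sum_distrib_right) (rule sum.swap)

lemma cdot_sum_right: "cdot v (sum u A) = (\<Sum>a\<in>A. cdot v (u a))"
  unfolding cdot_def by (simp add: sum_component sum_distrib_left) (rule sum.swap)

lemma cdot_axis_right: "cdot x (axis j 1) = x $ j"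
proof -
  have "cdot x (axis j 1) = (\<Sum>i\<in>UNIV. if i = j then x $ i else 0)"
    unfolding cdot_def by (rule sum.cong) (auto simp: axis_def)
  then show ?thesis
    by simp
qed

lemma cdot_axis_axis: "cdot (axis i 1) (axis j 1) = (if i = j then 1 else 0)"
  by (simp only: cdot_axis_right) (simp add: axis_def)

lemma cdot_matrix_axis_axis: "cdot (A *v axis i 1) (axis j 1) = A $ j $ i"
proof -
  have "(A *v axis i 1) $ j = A $ j $ i"
    unfolding matrix_vector_mult_def axis_def by (simp add: if_distrib[of "times _"] cong: if_cong)
  then show ?thesis
    by (simp add: cdot_axis_right)
qed

text \<open>By Schur's lemma \<open>transpose f ** h\<close> is a scalar; \<open>hom_pair f h\<close> is its trace.\<close>
lemma cdot_intertwiners: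
  fixes f h :: "complex^'r^'v"
  assumes R: "unitary_rep G \<rho>R" and R_irr: "irreducible_rep G \<rho>R" and V: "unitary_rep G \<rho>V"
    and f: "f \<in> equiv_maps G (dual_rep \<rho>R) (dual_rep \<rho>V)"
    and h: "h \<in> equiv_maps G \<rho>R \<rho>V"
  shows "cdot (f *v x) (h *v y) = hom_pair f h / of_nat CARD('r) * cdot x y"
proof -
  note R_inv = unitary_rep_invertible[OF R] and V_inv = unitary_rep_invertible[OF V]
  obtain c where c: "\<And>v. (transpose f ** h) *v v = c *s v"
    using irreducible_rep_commutant_scalar[OF R_irr transpose_mult_intertwines[OF R_inv V_inv f h]]
    by blast
  have cdot_c: "cdot (f *v x) (h *v y) = c * cdot x y" for x y
    by (simp add: cdot_transpose matrix_vector_mul_assoc c cdot_scale_right)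
  have "hom_pair f h = of_nat CARD('r) * c"
    unfolding hom_pair_def cdot_c by (simp add: cdot_axis_axis)
  then show ?thesis
    using cdot_c by simp
qed

lemma sum_swap3:
  "(\<Sum>a\<in>A. \<Sum>b\<in>B. \<Sum>c\<in>C. f a b c) = (\<Sum>c\<in>C. \<Sum>a\<in>A. \<Sum>b\<in>B. f a b c)"
  by (simp add: sum.swap[of _ B C] sum.swap[of _ A C])

lemma mat_comb_mult_vector: "mat_comb x b *v v = (\<Sum>i\<in>UNIV. x $ i *s (b i *v v))"
proof (rule Finite_Cartesian_Product.vec_eq_iff[THEN iffD2], rule allI)
  fix p
  have "(mat_comb x b *v v) $ p = (\<Sum>q\<in>UNIV. \<Sum>i\<in>UNIV. x $ i * b i $ p $ q * v $ q)"
    by (simp add: mat_comb_def matrix_vector_mult_def sum_distrib_right)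
  also have "\<dots> = (\<Sum>i\<in>UNIV. \<Sum>q\<in>UNIV. x $ i * b i $ p $ q * v $ q)"
    by (rule sum.swap)
  also have "\<dots> = (\<Sum>i\<in>UNIV. x $ i *s (b i *v v)) $ p"
    by (simp add: sum_component matrix_vector_mult_def sum_distrib_left mult_ac)
  finally show "(mat_comb x b *v v) $ p = (\<Sum>i\<in>UNIV. x $ i *s (b i *v v)) $ p" .
qed

lemma hom_pair_mat_comb_left: "hom_pair (mat_comb x b) h = (\<Sum>i\<in>UNIV. x $ i * hom_pair (b i) h)"
  unfolding hom_pair_def mat_comb_mult_vector
  by (simp add: cdot_sum_left cdot_scale_left sum_distrib_left) (rule sum.swap)

lemma hom_pair_mat_comb_right: "hom_pair f (mat_comb x b) = (\<Sum>i\<in>UNIV. x $ i * hom_pair f (b i))"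
  unfolding hom_pair_def mat_comb_mult_vector
  by (simp add: cdot_sum_right cdot_scale_right sum_distrib_left) (rule sum.swap)

definition coord_pair ::
    "('k::finite \<Rightarrow> complex^'r^'v) \<Rightarrow> ('l::finite \<Rightarrow> complex^'r^'v) \<Rightarrow> complex^'l \<Rightarrow> complex^'k \<Rightarrow> complex" where
  "coord_pair hb fb f h = (\<Sum>i\<in>UNIV. \<Sum>i'\<in>UNIV. f $ i * h $ i' * hom_pair (fb i) (hb i'))"

lemma hom_pair_mat_comb: "hom_pair (mat_comb f fb) (mat_comb h hb) = coord_pair hb fb f h"
  by (simp add: coord_pair_def hom_pair_mat_comb_left hom_pair_mat_comb_right sum_distrib_left mult_ac)
    (rule sum.swap)

lemma coord_pair_zero [simp]: "coord_pair hb fb 0 h = 0" "coord_pair hb fb f 0 = 0"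
  by (simp_all add: coord_pair_def)

lemma coord_pair_sum_left:
  "coord_pair hb fb (\<Sum>j\<in>J. c j *s f j) h = (\<Sum>j\<in>J. c j * coord_pair hb fb (f j) h)"
proof -
  have "coord_pair hb fb (\<Sum>j\<in>J. c j *s f j) h =
      (\<Sum>i\<in>UNIV. \<Sum>i'\<in>UNIV. \<Sum>j\<in>J. c j * (f j $ i * h $ i' * hom_pair (fb i) (hb i')))"
    by (simp add: coord_pair_def sum_component sum_distrib_left sum_distrib_right mult_ac)
  also have "\<dots> = (\<Sum>j\<in>J. \<Sum>i\<in>UNIV. \<Sum>i'\<in>UNIV. c j * (f j $ i * h $ i' * hom_pair (fb i) (hb i')))"
    by (rule sum_swap3)
  also have "\<dots> = (\<Sum>j\<in>J. c j * coord_pair hb fb (f j) h)"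
    by (simp add: coord_pair_def sum_distrib_left)
  finally show ?thesis .
qed

lemma column_matrix_mult: "column j (P ** Q) = P *v column j Q"
  by (simp add: Finite_Cartesian_Product.vec_eq_iff column_def matrix_matrix_mult_def
      matrix_vector_mult_def)

lemma column_add: "column j (P + Q) = column j P + column j Q"
  by (simp add: Finite_Cartesian_Product.vec_eq_iff column_def)

lemma column_mult_transpose:
  fixes Z :: "'a::comm_semiring_1^'n^'m"
  shows "column j (Z ** transpose P) = (\<Sum>j'\<in>UNIV. P $ j $ j' *s column j' Z)"
  by (simp add: Finite_Cartesian_Product.vec_eq_iff column_def matrix_matrix_mult_def transpose_def
      sum_component mult_ac)

lemma matrix_add_rdistrib: "(P + Q) ** R = P ** R + Q ** (R :: 'a::semiring_1^'c^'b)"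
  by (simp add: Finite_Cartesian_Product.vec_eq_iff matrix_matrix_mult_def ring_distribs sum.distrib)

lemma transpose_matrix_inv:
  fixes A :: "'a::field^'n^'n"
  assumes "invertible A"
  shows "transpose A ** transpose (matrix_inv A) = mat 1"
    and "transpose (matrix_inv A) ** transpose A = mat 1"
  using invertible_matrix_inv[OF assms] by (metis matrix_transpose_mul transpose_mat)+

text \<open>The identification \<open>(H \<otimes> R) \<oplus> (H\<^sup>* \<otimes> R\<^sup>*) \<cong> (H \<oplus> H\<^sup>*) \<otimes> R\<close> through
  \<open>Id \<oplus> (Id \<otimes> \<psi>\<^sup>-\<^sup>1)\<close>, read off in the coordinates of \<open>R\<close>.\<close>
definition column_split ::
    "complex^'r^'r \<Rightarrow> (complex^'r^'k) \<times> (complex^'r^'l) \<Rightarrow> 'r \<Rightarrow> (complex^'k) \<times> (complex^'l)"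
  where
  "column_split \<psi> X j = (column j (fst X), column j (snd X ** transpose (matrix_inv \<psi>)))"

lemma column_split_surj:
  fixes \<psi> :: "complex^'r^'r"
  assumes "invertible \<psi>"
  shows "surj (column_split \<psi>)"
  unfolding surj_def
proof
  fix fam :: "'r::finite \<Rightarrow> (complex^'k) \<times> (complex^'l)"
  define Z where "Z = (\<chi> i j. snd (fam j) $ i)"
  have "fam = column_split \<psi> ((\<chi> i j. fst (fam j) $ i), Z ** transpose \<psi>)"
    by (rule ext) (simp add: column_split_def transpose_matrix_inv[OF assms] flip: matrix_mul_assoc,
        simp add: column_def Z_def Finite_Cartesian_Product.vec_eq_iff prod_eq_iff)
  then show "\<exists>X. fam = column_split \<psi> X" ..
qed

lemma column_split_Phi_op:
  assumes "invertible \<psi>"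
  shows "column_split \<psi> (Phi_op \<psi> A B K D X) j = block_op A B K D (column_split \<psi> X j)"
proof -
  obtain X1 X2 where X: "X = (X1, X2)" by (cases X)
  have "A ** X1 + B ** X2 ** transpose (matrix_inv \<psi>) = A ** X1 + B ** (X2 ** transpose (matrix_inv \<psi>))"
    by (simp add: matrix_mul_assoc)
  moreover have "(K ** X1 ** transpose \<psi> + D ** X2) ** transpose (matrix_inv \<psi>)
      = K ** X1 + D ** (X2 ** transpose (matrix_inv \<psi>))"
    by (simp add: matrix_add_rdistrib transpose_matrix_inv[OF assms] flip: matrix_mul_assoc)
  ultimately show ?thesis
    by (simp add: X column_split_def Phi_op_def block_op_def column_add column_matrix_mult)
qed

lemma tensor_eval_columns:
  "(\<chi> p. \<Sum>i\<in>UNIV. \<Sum>j\<in>UNIV. X $ i $ j * (b i *v axis j 1) $ p)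
    = (\<Sum>j\<in>UNIV. mat_comb (column j X) b *v axis j 1)"
proof (rule Finite_Cartesian_Product.vec_eq_iff[THEN iffD2], rule allI)
  fix p
  have "(\<Sum>i\<in>UNIV. \<Sum>j\<in>UNIV. X $ i $ j * (b i *v axis j 1) $ p)
      = (\<Sum>j\<in>UNIV. \<Sum>i\<in>UNIV. X $ i $ j * (b i *v axis j 1) $ p)"
    by (rule sum.swap)
  then show "(\<chi> p. \<Sum>i\<in>UNIV. \<Sum>j\<in>UNIV. X $ i $ j * (b i *v axis j 1) $ p) $ p
      = (\<Sum>j\<in>UNIV. mat_comb (column j X) b *v axis j 1) $ p"
    by (simp add: sum_component mat_comb_mult_vector column_def)
qed

lemma eps_columns:
  "eps hb fb X = ((\<Sum>j\<in>UNIV. mat_comb (column j (fst X)) hb *v axis j 1),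
                 (\<Sum>j\<in>UNIV. mat_comb (column j (snd X)) fb *v axis j 1))"
  by (cases X) (simp add: eps_def tensor_eval_columns)

lemma cdot_eps:
  fixes hb :: "'k::finite \<Rightarrow> complex^'r^'v" and fb :: "'l::finite \<Rightarrow> complex^'r^'v"
  assumes R: "unitary_rep G \<rho>R" and R_irr: "irreducible_rep G \<rho>R" and V: "unitary_rep G \<rho>V"
    and hb: "\<And>x. mat_comb x hb \<in> equiv_maps G \<rho>R \<rho>V"
    and fb: "\<And>x. mat_comb x fb \<in> equiv_maps G (dual_rep \<rho>R) (dual_rep \<rho>V)"
  shows "cdot (snd (eps hb fb X)) (fst (eps hb fb Y))
    = (\<Sum>j\<in>UNIV. coord_pair hb fb (column j (snd X)) (column j (fst Y))) / of_nat CARD('r)"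
proof -
  have "cdot (snd (eps hb fb X)) (fst (eps hb fb Y)) =
      (\<Sum>j'\<in>UNIV. \<Sum>j\<in>UNIV. hom_pair (mat_comb (column j (snd X)) fb) (mat_comb (column j' (fst Y)) hb)
        / of_nat CARD('r) * (if j = j' then 1 else 0))"
    unfolding eps_columns fst_conv snd_conv cdot_sum_left cdot_sum_right
    by (simp only: cdot_intertwiners[OF R R_irr V fb hb] cdot_axis_axis)
  then show ?thesis
    by (simp add: if_distrib hom_pair_mat_comb sum_divide_distrib cong: if_cong)
qed

lemma cdot_eps_column_split:
  fixes hb :: "'k::finite \<Rightarrow> complex^'r^'v" and fb :: "'l::finite \<Rightarrow> complex^'r^'v"
  assumes R: "unitary_rep G \<rho>R" and R_irr: "irreducible_rep G \<rho>R" and V: "unitary_rep G \<rho>V"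
    and hb: "\<And>x. mat_comb x hb \<in> equiv_maps G \<rho>R \<rho>V"
    and fb: "\<And>x. mat_comb x fb \<in> equiv_maps G (dual_rep \<rho>R) (dual_rep \<rho>V)"
    and \<psi>: "invertible \<psi>"
  shows "cdot (snd (eps hb fb X)) (fst (eps hb fb Y))
    = (\<Sum>j\<in>UNIV. \<Sum>j'\<in>UNIV. \<psi> $ j $ j' *
         coord_pair hb fb (snd (column_split \<psi> X j')) (fst (column_split \<psi> Y j))) / of_nat CARD('r)"
proof -
  define Z where "Z = snd X ** transpose (matrix_inv \<psi>)"
  have "snd X = Z ** transpose \<psi>"
    by (simp add: Z_def transpose_matrix_inv[OF \<psi>] flip: matrix_mul_assoc)
  then have "column j (snd X) = (\<Sum>j'\<in>UNIV. \<psi> $ j $ j' *s column j' Z)" for j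
    by (simp add: column_mult_transpose)
  then show ?thesis
    by (simp add: cdot_eps[OF R R_irr V hb fb] coord_pair_sum_left column_split_def Z_def)
qed

lemma form_b_column_split:
  fixes hb :: "'k::finite \<Rightarrow> complex^'r^'v" and fb :: "'l::finite \<Rightarrow> complex^'r^'v"
  assumes R: "unitary_rep G \<rho>R" and R_irr: "irreducible_rep G \<rho>R" and V: "unitary_rep G \<rho>V"
    and hb: "\<And>x. mat_comb x hb \<in> equiv_maps G \<rho>R \<rho>V"
    and fb: "\<And>x. mat_comb x fb \<in> equiv_maps G (dual_rep \<rho>R) (dual_rep \<rho>V)"
    and \<psi>: "invertible \<psi>" and \<psi>_sign: "\<And>j j'. \<psi> $ j' $ j = \<sigma> * \<psi> $ j $ j'"
    and F: "\<And>h1 f1 h2 f2. F (h1, f1) (h2, f2) = coord_pair hb fb f1 h2 + \<sigma> * coord_pair hb fb f2 h1"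
  shows "form_b hb fb X Y
    = (\<Sum>j\<in>UNIV. \<Sum>j'\<in>UNIV. \<psi> $ j $ j' * F (column_split \<psi> X j') (column_split \<psi> Y j)) / of_nat CARD('r)"
proof -
  define P :: "(complex^'r^'k) \<times> (complex^'r^'l) \<Rightarrow> (complex^'r^'k) \<times> (complex^'r^'l) \<Rightarrow> 'r \<Rightarrow> 'r \<Rightarrow> complex"
    where "P X Y j j' = coord_pair hb fb (snd (column_split \<psi> X j')) (fst (column_split \<psi> Y j))"
    for X Y j j'
  have half: "cdot (snd (eps hb fb X')) (fst (eps hb fb Y'))
      = (\<Sum>j\<in>UNIV. \<Sum>j'\<in>UNIV. \<psi> $ j $ j' * P X' Y' j j') / of_nat CARD('r)" for X' Y'
    unfolding P_def by (rule cdot_eps_column_split[OF R R_irr V hb fb \<psi>])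
  have "(\<Sum>j\<in>UNIV. \<Sum>j'\<in>UNIV. \<psi> $ j $ j' * P Y X j j')
      = (\<Sum>j\<in>UNIV. \<Sum>j'\<in>UNIV. \<psi> $ j' $ j * P Y X j' j)"
    by (rule sum.swap)
  also have "\<dots> = (\<Sum>j\<in>UNIV. \<Sum>j'\<in>UNIV. \<sigma> * \<psi> $ j $ j' * P Y X j' j)"
    by (intro sum.cong refl) (metis \<psi>_sign)
  finally have swapped: "(\<Sum>j\<in>UNIV. \<Sum>j'\<in>UNIV. \<psi> $ j $ j' * P Y X j j')
      = (\<Sum>j\<in>UNIV. \<Sum>j'\<in>UNIV. \<sigma> * \<psi> $ j $ j' * P Y X j' j)" .
  have F_P: "F (column_split \<psi> X j') (column_split \<psi> Y j) = P X Y j j' + \<sigma> * P Y X j' j" for j j'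
    by (simp add: F P_def column_split_def)
  have "form_b hb fb X Y
      = cdot (snd (eps hb fb X)) (fst (eps hb fb Y)) + cdot (snd (eps hb fb Y)) (fst (eps hb fb X))"
    by (simp add: form_b_def form_b0_def split: prod.split)
  also have "\<dots> = (\<Sum>j\<in>UNIV. \<Sum>j'\<in>UNIV. \<psi> $ j $ j' * P X Y j j') / of_nat CARD('r)
      + (\<Sum>j\<in>UNIV. \<Sum>j'\<in>UNIV. \<sigma> * \<psi> $ j $ j' * P Y X j' j) / of_nat CARD('r)"
    by (simp only: half swapped)
  also have "\<dots> = (\<Sum>j\<in>UNIV. \<Sum>j'\<in>UNIV. \<psi> $ j $ j' * (P X Y j j' + \<sigma> * P Y X j' j))
      / of_nat CARD('r)"
    by (simp add: add_divide_distrib sum.distrib distrib_left mult_ac)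
  finally show ?thesis
    by (simp only: F_P)
qed

text \<open>Here \<open>u X j\<close> is the \<open>j\<close>-th coordinate of \<open>X\<close> in \<open>W \<otimes> R\<close>, \<open>T = M \<otimes> Id\<close> and \<open>b = c (F \<otimes> \<beta>)\<close>.
  To pass from \<open>b\<close> back to \<open>F\<close>, test on the pure tensors \<open>w\<^sub>1 \<otimes> e\<^sub>j\<^sub>0\<close> and \<open>w\<^sub>2 \<otimes> e\<^sub>j\<^sub>1\<close>.\<close>
lemma tensor_form_respects_iff:
  fixes u :: "'x \<Rightarrow> 'j::finite \<Rightarrow> 'w::zero" and T :: "'x \<Rightarrow> 'x" and M :: "'w \<Rightarrow> 'w"
    and F :: "'w \<Rightarrow> 'w \<Rightarrow> complex" and b :: "'x \<Rightarrow> 'x \<Rightarrow> complex" and \<beta> :: "'j \<Rightarrow> 'j \<Rightarrow> complex"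
  assumes u_surj: "surj u" and u_T: "\<And>X j. u (T X) j = M (u X j)"
    and b: "\<And>X Y. b X Y = c * (\<Sum>j\<in>UNIV. \<Sum>j'\<in>UNIV. \<beta> j j' * F (u X j') (u Y j))"
    and F0: "\<And>w. F 0 w = 0" "\<And>w. F w 0 = 0" and M0: "M 0 = 0"
    and c: "c \<noteq> 0" and \<beta>: "\<beta> j1 j0 \<noteq> 0"
  shows "respects_isometry b T \<longleftrightarrow> respects_isometry F M"
    and "respects_infinitesimal b T \<longleftrightarrow> respects_infinitesimal F M"
proof -
  have b_delta: "b X Y = c * (\<beta> j1 j0 * F w1 w2)"
    if X: "u X = (\<lambda>j. if j = j0 then w1 else 0)" and Y: "u Y = (\<lambda>j. if j = j1 then w2 else 0)"
    for X Y w1 w2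
  proof -
    have "\<beta> j j' * F (u X j') (u Y j) = (if j' = j0 then if j = j1 then \<beta> j1 j0 * F w1 w2 else 0 else 0)"
      for j j'
      using X Y F0 by auto
    then show ?thesis
      by (simp add: b)
  qed
  have "\<exists>X. u X = (\<lambda>j. if j = j0 then w else 0)" "\<exists>Y. u Y = (\<lambda>j. if j = j1 then w else 0)" for w
    using u_surj by (metis surjD)+
  then obtain X Y where X: "\<And>w. u (X w) = (\<lambda>j. if j = j0 then w else 0)"
    and Y: "\<And>w. u (Y w) = (\<lambda>j. if j = j1 then w else 0)"
    by metis
  have TX: "u (T (X w)) = (\<lambda>j. if j = j0 then M w else 0)" and TY: "u (T (Y w)) = (\<lambda>j. if j = j1 then M w else 0)"
    for w
    using X Y M0 by (auto simp: u_T)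
  show "respects_isometry b T \<longleftrightarrow> respects_isometry F M"
  proof
    assume "respects_isometry b T"
    then have "b (T (X w1)) (T (Y w2)) = b (X w1) (Y w2)" for w1 w2
      by (simp add: respects_isometry_def)
    then show "respects_isometry F M"
      using c \<beta> by (simp add: respects_isometry_def b_delta[OF X Y] b_delta[OF TX TY])
  next
    assume "respects_isometry F M"
    then show "respects_isometry b T"
      by (simp add: respects_isometry_def b u_T)
  qed
  show "respects_infinitesimal b T \<longleftrightarrow> respects_infinitesimal F M"
  proof
    assume "respects_infinitesimal b T"
    then have "b (T (X w1)) (Y w2) + b (X w1) (T (Y w2)) = 0" for w1 w2
      by (simp add: respects_infinitesimal_def)
    then show "respects_infinitesimal F M"
      using c \<beta> by (simp add: respects_infinitesimal_def b_delta[OF X TY] b_delta[OF TX Y]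
          flip: distrib_left)
  next
    assume F_inf: "respects_infinitesimal F M"
    have "b (T X) Y + b X (T Y)
        = c * (\<Sum>j\<in>UNIV. \<Sum>j'\<in>UNIV. \<beta> j j' * (F (M (u X j')) (u Y j) + F (u X j') (M (u Y j))))"
      for X Y
      by (simp add: b u_T ring_distribs sum.distrib)
    then show "respects_infinitesimal b T"
      using F_inf by (simp add: respects_infinitesimal_def)
  qed
qed

lemma Phi_op_respects_iff:
  fixes hb :: "'k::finite \<Rightarrow> complex^'r^'v" and fb :: "'l::finite \<Rightarrow> complex^'r^'v"
  assumes R: "unitary_rep G \<rho>R" and R_irr: "irreducible_rep G \<rho>R" and V: "unitary_rep G \<rho>V"
    and hb: "\<And>x. mat_comb x hb \<in> equiv_maps G \<rho>R \<rho>V"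
    and fb: "\<And>x. mat_comb x fb \<in> equiv_maps G (dual_rep \<rho>R) (dual_rep \<rho>V)"
    and \<psi>: "invertible \<psi>" and \<psi>_sign: "\<forall>r t. cdot (\<psi> *v r) t = \<sigma> * cdot (\<psi> *v t) r"
    and F: "\<And>h1 f1 h2 f2. F (h1, f1) (h2, f2)
      = hom_pair (mat_comb f1 fb) (mat_comb h2 hb) + \<sigma> * hom_pair (mat_comb f2 fb) (mat_comb h1 hb)"
  shows "respects_isometry (form_b hb fb) (Phi_op \<psi> A B K D) \<longleftrightarrow> respects_isometry F (block_op A B K D)"
    and "respects_infinitesimal (form_b hb fb) (Phi_op \<psi> A B K D)
      \<longleftrightarrow> respects_infinitesimal F (block_op A B K D)"
proof -
  obtain j1 j0 where \<psi>_entry: "\<psi> $ j1 $ j0 \<noteq> 0"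
    using invertible_nonzero_entry[OF \<psi>] .
  have \<psi>_transpose: "\<psi> $ j' $ j = \<sigma> * \<psi> $ j $ j'" for j j'
    using \<psi>_sign[rule_format, of "axis j 1" "axis j' 1"] by (simp add: cdot_matrix_axis_axis)
  have F_coord: "F (h1, f1) (h2, f2) = coord_pair hb fb f1 h2 + \<sigma> * coord_pair hb fb f2 h1"
    for h1 f1 h2 f2
    using F by (simp add: hom_pair_mat_comb)
  have F0: "F 0 w = 0" "F w 0 = 0" for w
    by (cases w, simp add: F_coord zero_prod_def)+
  have M0: "block_op A B K D 0 = 0"
    by (simp add: block_op_def zero_prod_def)
  have "form_b hb fb X Y = inverse (of_nat CARD('r))
      * (\<Sum>j\<in>UNIV. \<Sum>j'\<in>UNIV. \<psi> $ j $ j' * F (column_split \<psi> X j') (column_split \<psi> Y j))" for X Y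
    using form_b_column_split[OF R R_irr V hb fb \<psi> \<psi>_transpose F_coord]
    by (simp add: divide_inverse_commute)
  note transfer = tensor_form_respects_iff[OF column_split_surj[OF \<psi>]
      column_split_Phi_op[OF \<psi>, where A = A and B = B and K = K and D = D] this F0 M0 _ \<psi>_entry]
  show "respects_isometry (form_b hb fb) (Phi_op \<psi> A B K D) \<longleftrightarrow> respects_isometry F (block_op A B K D)"
    and "respects_infinitesimal (form_b hb fb) (Phi_op \<psi> A B K D)
      \<longleftrightarrow> respects_infinitesimal F (block_op A B K D)"
    by (simp_all add: transfer)
qed

theorem proposition3p13:
  fixes G :: "('g::t2_space, 'z) monoid_scheme"
    and \<rho>R :: "'g \<Rightarrow> complex^'r^'r"
    and \<rho>V :: "'g \<Rightarrow> complex^'v^'v"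
    and hb :: "'k::finite \<Rightarrow> complex^'r^'v"
    and fb :: "'l::finite \<Rightarrow> complex^'r^'v"
    and \<psi> :: "complex^'r^'r"
    and A :: "complex^'k^'k" and B :: "complex^'l^'k"
    and K :: "complex^'k^'l" and D :: "complex^'l^'l"
  assumes G: "compact_group G"
    and R_rep: "unitary_rep G \<rho>R" and R_irr: "irreducible_rep G \<rho>R"
    and R_selfdual: "\<exists>P::complex^'r^'r. invertible P \<and> (\<forall>g\<in>carrier G. P ** \<rho>R g = dual_rep \<rho>R g ** P)"
    and V_rep: "unitary_rep G \<rho>V"
    and V_isotypic: "\<And>W. irreducible_subrep G \<rho>V W \<Longrightarrow> subrep_iso G \<rho>R \<rho>V W"
    and H_basis: "is_mat_basis hb (equiv_maps G \<rho>R \<rho>V)"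
    and Hd_basis: "is_mat_basis fb (equiv_maps G (dual_rep \<rho>R) (dual_rep \<rho>V))"
    and eps_iso: "bij (eps hb fb)"
    and \<psi>_iso: "invertible \<psi>"
    and \<psi>_equiv: "\<forall>g\<in>carrier G. \<psi> ** \<rho>R g = dual_rep \<rho>R g ** \<psi>"
  shows "((\<forall>r t. cdot (\<psi> *v r) t = cdot (\<psi> *v t) r) \<longrightarrow>
            (bij (block_op A B K D) \<longrightarrow>
               (respects_isometry (form_b hb fb) (Phi_op \<psi> A B K D)
                \<longleftrightarrow> respects_isometry (form_s hb fb) (block_op A B K D))) \<and>
            (respects_infinitesimal (form_b hb fb) (Phi_op \<psi> A B K D)
               \<longleftrightarrow> respects_infinitesimal (form_s hb fb) (block_op A B K D))) \<and>
         ((\<forall>r t. cdot (\<psi> *v r) t = - cdot (\<psi> *v t) r) \<longrightarrow>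
            (bij (block_op A B K D) \<longrightarrow>
               (respects_isometry (form_b hb fb) (Phi_op \<psi> A B K D)
                \<longleftrightarrow> respects_isometry (form_a hb fb) (block_op A B K D))) \<and>
            (respects_infinitesimal (form_b hb fb) (Phi_op \<psi> A B K D)
               \<longleftrightarrow> respects_infinitesimal (form_a hb fb) (block_op A B K D)))"
proof -
  have hb: "\<And>x. mat_comb x hb \<in> equiv_maps G \<rho>R \<rho>V"
    using H_basis by (simp add: is_mat_basis_def)
  have fb: "\<And>x. mat_comb x fb \<in> equiv_maps G (dual_rep \<rho>R) (dual_rep \<rho>V)"
    using Hd_basis by (simp add: is_mat_basis_def)
  note transfer = Phi_op_respects_iff[OF R_rep R_irr V_rep hb fb \<psi>_iso]
  have s: "form_s hb fb (h1, f1) (h2, f2)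
      = hom_pair (mat_comb f1 fb) (mat_comb h2 hb) + 1 * hom_pair (mat_comb f2 fb) (mat_comb h1 hb)"
    for h1 f1 h2 f2 by (simp add: form_s_def)
  have a: "form_a hb fb (h1, f1) (h2, f2)
      = hom_pair (mat_comb f1 fb) (mat_comb h2 hb) + -1 * hom_pair (mat_comb f2 fb) (mat_comb h1 hb)"
    for h1 f1 h2 f2 by (simp add: form_a_def)
  have sym: "(\<forall>r t. cdot (\<psi> *v r) t = cdot (\<psi> *v t) r)
      \<longleftrightarrow> (\<forall>r t. cdot (\<psi> *v r) t = 1 * cdot (\<psi> *v t) r)"
    by simp
  have alt: "(\<forall>r t. cdot (\<psi> *v r) t = - cdot (\<psi> *v t) r)
      \<longleftrightarrow> (\<forall>r t. cdot (\<psi> *v r) t = -1 * cdot (\<psi> *v t) r)"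
    by simp
  show ?thesis
    unfolding sym alt using transfer[OF _ s] transfer[OF _ a] by blast
qed

end
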